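(* Let $n\ge 3$ and let $G_n$ be the Gegenbauer polynomial of degree $n$ in the sense of the context. Denote by $\zeta_1<\cdots<\zeta_l<0$ the negative roots of the $k$-th derivative $G_n^{(k)}$, where $l=[(n-k)/2]$, and denote by $\mu_1<\cdots<\mu_{l-1}<0$ the negative roots of $G_n^{(k+2)}$. Then $\mu_i\in(\zeta_i,\zeta_{i+1})$ for $i=1,\ldots,l-1$.
   Context: For $n\ge3$, the Gegenbauer polynomial $G_n$ of degree $n$ is here defined as the polynomial in one variable which is divisible by its second derivative and whose first three coefficients (of $x^n$, $x^{n-1}$, $x^{n-2}$) equal $1$, $0$, $-1$. These conditions define a unique polynomial, which has only real and distinct roots and which is even (resp. odd) when $n$ is even (resp. odd). Hence its nonconstant derivatives which are polynomials of even (resp. odd) degree are even (resp. odd) polynomials. $[\cdot]$ denotes the integer part, and $G_n^{(k)}$ denotes the derivative of order $k$ of $G_n$.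
   Formalization: The order k is taken with 1 ≤ k ≤ n−2: for k = 0 the claim fails (n = 4: G_4 = x^4−x^2+5/36 has μ_1 = ζ_2 = −1/√6), and for k > n−2 one has l = 0, so the list of l−1 roots is undefined. *)

theory Defs
  imports Complex_Main "HOL-Computational_Algebra.Polynomial"
begin

definition is_gegenbauer :: "nat \<Rightarrow> real poly \<Rightarrow> bool" where
  "is_gegenbauer n p \<longleftrightarrow>
     degree p = n \<and> coeff p n = 1 \<and> coeff p (n - 1) = 0 \<and> coeff p (n - 2) = -1 \<and>
     pderiv (pderiv p) dvd p"

text \<open>Well defined for \<open>n \<ge> 3\<close>, see \<open>is_gegenbauer_ex1\<close> below.\<close>

definition gegenbauer :: "nat \<Rightarrow> real poly" where
  "gegenbauer n = (THE p. is_gegenbauer n p)"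

definition neg_roots :: "real poly \<Rightarrow> real set" where
  "neg_roots p = {x. x < 0 \<and> poly p x = 0}"

text \<open>\<open>f 1 < \<dots> < f m\<close> are exactly the elements of \<open>A\<close>; values of \<open>f\<close> outside \<open>{1..m}\<close>
  are irrelevant.\<close>

definition increasing_enumeration :: "(nat \<Rightarrow> real) \<Rightarrow> nat \<Rightarrow> real set \<Rightarrow> bool" where
  "increasing_enumeration f m A \<longleftrightarrow> strict_mono_on {1..m} f \<and> f ` {1..m} = A"

lemma coeff_quadratic_times_pderiv2:
  fixes p :: "real poly"
  shows "coeff ([:c, b, a:] * pderiv (pderiv p)) m =
    c * (real m + 2) * (real m + 1) * coeff p (m + 2) + b * (real m + 1) * real m * coeff p (m + 1)
    + a * real m * (real m - 1) * coeff p m"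
proof (cases m)
  case 0
  then show ?thesis by (simp add: coeff_pderiv numeral_2_eq_2)
next
  case (Suc m')
  show ?thesis
  proof (cases m')
    case 0
    with Suc show ?thesis by (simp add: coeff_pderiv numeral_2_eq_2 numeral_3_eq_3)
  next
    case (Suc m'')
    with \<open>m = Suc m'\<close> show ?thesis
      by (simp add: coeff_pderiv algebra_simps)
  qed
qed

lemma gegenbauer_denominator_pos:
  assumes "n \<ge> 2" "m < (n::nat)"
  shows "1 - real m * (real m - 1) / (real n * (real n - 1)) > 0"
proof -
  have "real m * (real m - 1) < real n * (real n - 1)"
  proof (cases "m = 0")
    case True
    then show ?thesis using assms by simp
  next
    case False
    then show ?thesis using assms by (intro mult_strict_mono) auto
  qed
  moreover have "real n * (real n - 1) > 0" using assms by simp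
  ultimately show ?thesis by (simp add: field_simps)
qed

text \<open>The cofactor of the second derivative is forced to be
  \<open>(x\<^sup>2 + const) / (n * (n - 1))\<close>.\<close>

definition gegenbauer_const :: "nat \<Rightarrow> real" where
  "gegenbauer_const n =
     - (1 - real (n - 2) * (real (n - 2) - 1) / (real n * (real n - 1))) / (real n * (real n - 1))"

lemma is_gegenbauer_cofactor:
  assumes n: "n \<ge> 3" and p: "is_gegenbauer n p"
  shows "p = [:gegenbauer_const n, 0, 1 / (real n * (real n - 1)):] * pderiv (pderiv p)"
proof -
  let ?D = "real n * (real n - 1)"
  have D: "?D > 0" using n by simp
  from p have deg: "degree p = n" and cn: "coeff p n = 1" and cn1: "coeff p (n - 1) = 0"
    and cn2: "coeff p (n - 2) = -1" and dvd: "pderiv (pderiv p) dvd p"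
    by (auto simp: is_gegenbauer_def)
  from dvd obtain q where q: "p = q * pderiv (pderiv p)"
    by (metis dvdE mult.commute)
  have p0: "p \<noteq> 0" using cn by auto
  have dd: "degree (pderiv (pderiv p)) = n - 2"
    by (simp add: degree_pderiv deg)
  have "q \<noteq> 0" "pderiv (pderiv p) \<noteq> 0" using p0 q by auto
  then have "n = degree q + (n - 2)"
    using q dd deg by (metis degree_mult_eq)
  then have dq: "degree q = 2" using n by simp
  obtain c b a where qq: "q = [:c, b, a:]"
  proof
    show "q = [:coeff q 0, coeff q 1, coeff q 2:]"
    proof (rule poly_eqI)
      fix i
      show "coeff q i = coeff [:coeff q 0, coeff q 1, coeff q 2:] i"
        using dq by (auto simp: coeff_pCons coeff_eq_0 numeral_2_eq_2 split: nat.split)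
    qed
  qed
  have C: "coeff p m = c * (real m + 2) * (real m + 1) * coeff p (m + 2)
      + b * (real m + 1) * real m * coeff p (m + 1) + a * real m * (real m - 1) * coeff p m" for m
    using q qq coeff_quadratic_times_pderiv2 by metis
  have hi: "coeff p m = 0" if "m > n" for m using that deg by (simp add: coeff_eq_0)
  have a: "a = 1 / ?D"
    using C[of n] n by (simp add: hi cn eq_divide_eq mult.assoc)
  have b: "b = 0"
    using C[of "n - 1"] n hi cn cn1 by (simp add: of_nat_diff)
  have nn: "n - 2 + 2 = n" "n - 2 + 1 = n - 1" using n by auto
  have r: "real (n - 2) = real n - 2" using n by simp
  have "-1 = c * ?D - a * real (n - 2) * (real (n - 2) - 1)"
    using C[of "n - 2", unfolded nn cn cn1 cn2] by (simp add: r algebra_simps)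
  then have "c * ?D = - (1 - real (n - 2) * (real (n - 2) - 1) / ?D)"
    unfolding a by simp
  then have "c = gegenbauer_const n"
    using D unfolding gegenbauer_const_def by (subst eq_divide_eq) auto
  with a b qq q show ?thesis by simp
qed

lemma is_gegenbauer_unique:
  assumes n: "n \<ge> 3" and p: "is_gegenbauer n p" and q: "is_gegenbauer n q"
  shows "p = q"
proof -
  let ?a = "1 / (real n * (real n - 1))"
  have rec: "(1 - real m * (real m - 1) / (real n * (real n - 1))) * coeff p m =
     gegenbauer_const n * (real m + 2) * (real m + 1) * coeff p (m + 2)"
    if "is_gegenbauer n p" for p m
  proof -
    have "coeff p m = coeff ([:gegenbauer_const n, 0, ?a:] * pderiv (pderiv p)) m"
      using is_gegenbauer_cofactor[OF n that] by simp
    then show ?thesis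
      unfolding coeff_quadratic_times_pderiv2 by (simp add: algebra_simps)
  qed
  have "coeff p m = coeff q m" for m
  proof (induction "n - m" arbitrary: m rule: less_induct)
    case less
    show ?case
    proof (cases "m < n")
      case False
      then show ?thesis using p q
        by (cases "m = n") (auto simp: is_gegenbauer_def coeff_eq_0)
    next
      case True
      then have "coeff p (m + 2) = coeff q (m + 2)" by (intro less) auto
      then show ?thesis
        using rec[OF p, of m] rec[OF q, of m] gegenbauer_denominator_pos[of n m] n True
        by (metis (no_types, lifting) less_irrefl mult_left_cancel numeral_le_iff order_trans
            semiring_norm(69,72) eval_nat_numeral(3) le_SucI nle_le)
    qed
  qed
  then show ?thesis by (rule poly_eqI)
qed

fun gegenbauer_coeff :: "nat \<Rightarrow> nat \<Rightarrow> real" where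
  "gegenbauer_coeff n 0 = 1"
| "gegenbauer_coeff n (Suc j) = (let m = n - 2 * Suc j in
     gegenbauer_const n * (real m + 2) * (real m + 1) * gegenbauer_coeff n j /
     (1 - real m * (real m - 1) / (real n * (real n - 1))))"

lemma is_gegenbauer_exists:
  assumes n: "n \<ge> 3"
  shows "\<exists>p. is_gegenbauer n p"
proof -
  let ?D = "real n * (real n - 1)"
  have D: "?D > 0" using n by simp
  define f where "f m = (if m \<le> n \<and> even (n - m) then gegenbauer_coeff n ((n - m) div 2) else 0)" for m
  define p where "p = Abs_poly f"
  have cp: "coeff p m = f m" for m
    unfolding p_def by (subst coeff_Abs_poly[of n]) (auto simp: f_def)
  have fn: "f n = 1" by (simp add: f_def)
  have fn1: "f (n - 1) = 0" using n by (simp add: f_def)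
  have fn2: "f (n - 2) = -1"
  proof -
    have "1 - real (n - 2) * (real (n - 2) - 1) / ?D > 0"
      using gegenbauer_denominator_pos[of n "n - 2"] n by simp
    moreover have "real (n - 2) = real n - 2" using n by simp
    moreover have "f (n - 2) = gegenbauer_coeff n (Suc 0)" using n by (simp add: f_def)
    ultimately show ?thesis using D
      by (simp add: gegenbauer_const_def Let_def numeral_2_eq_2 divide_simps)
  qed
  have rec: "(1 - real m * (real m - 1) / ?D) * f m = gegenbauer_const n * (real m + 2) * (real m + 1) * f (m + 2)"
    for m
  proof -
    consider "m > n" | "m = n" | "m < n" "odd (n - m)" | j where "n = m + 2 * Suc j"
    proof -
      assume a: "m > n \<Longrightarrow> thesis" "m = n \<Longrightarrow> thesis" "\<lbrakk>m < n; odd (n - m)\<rbrakk> \<Longrightarrow> thesis"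
        "\<And>j. n = m + 2 * Suc j \<Longrightarrow> thesis"
      show thesis
      proof (cases "m < n \<and> even (n - m)")
        case True
        then have "n = m + 2 * Suc ((n - m) div 2 - 1)" by presburger
        then show thesis by (rule a(4))
      next
        case False
        then show thesis using a(1-3) by (metis nat_neq_iff)
      qed
    qed
    then show ?thesis
    proof cases
      case 1 then show ?thesis by (simp add: f_def)
    next
      case 2 then show ?thesis using n by (simp add: f_def)
    next
      case 3 then show ?thesis by (auto simp: f_def)
    next
      case 4
      have m: "n - 2 * Suc j = m" using 4 by simp
      have 1: "f m = gegenbauer_coeff n (Suc j)" unfolding f_def using 4 by simp
      have 2: "f (m + 2) = gegenbauer_coeff n j" unfolding f_def using 4 by simp
      have "1 - real m * (real m - 1) / ?D \<noteq> 0"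
        using gegenbauer_denominator_pos[of n m] n 4 by auto
      then show ?thesis
        unfolding 1 2 gegenbauer_coeff.simps m Let_def by simp
    qed
  qed
  have "p = [:gegenbauer_const n, 0, 1 / ?D:] * pderiv (pderiv p)"
    by (rule poly_eqI, unfold coeff_quadratic_times_pderiv2 cp)
       (use rec in \<open>simp add: algebra_simps\<close>)
  then have "pderiv (pderiv p) dvd p" by (metis dvd_triv_right)
  moreover have "degree p = n"
    by (rule antisym, rule degree_le) (auto simp: cp f_def le_degree)
  ultimately have "is_gegenbauer n p"
    using fn fn1 fn2 by (simp add: is_gegenbauer_def cp)
  then show ?thesis ..
qed

lemma is_gegenbauer_ex1: "n \<ge> 3 \<Longrightarrow> \<exists>!p. is_gegenbauer n p"
  using is_gegenbauer_exists is_gegenbauer_unique by blast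

lemma is_gegenbauer_gegenbauer: "n \<ge> 3 \<Longrightarrow> is_gegenbauer n (gegenbauer n)"
  unfolding gegenbauer_def by (rule theI') (rule is_gegenbauer_ex1)

end

theory Submission imports Defs begin

text \<open>
  Differentiating \<open>n (n - 1) G = (x\<^sup>2 - s\<^sup>2) G''\<close> shows that \<open>y = G\<^sup>(\<^sup>k\<^sup>)\<close> satisfies
  \<open>(x\<^sup>2 - s\<^sup>2) y'' + 2 k x y' = \<lambda> y\<close> with \<open>\<lambda> > 0\<close> for \<open>k < n\<close>. Suppose that \<open>k \<ge> 1\<close> and that
  all roots of \<open>y'\<close> are simple and lie in \<open>(-s, s)\<close>. At the roots of \<open>y'\<close> the sign of \<open>y\<close> is
  opposite to that of \<open>y''\<close>, and at \<open>\<plusminus>s\<close> it is read off from \<open>y'\<close>; so \<open>y\<close> alternates in sign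
  on these points, and its roots are simple and lie in \<open>(-s, s)\<close> as well. At a negative root of \<open>y\<close>
  the equation says that \<open>y''\<close> and \<open>y'\<close> have opposite signs. As \<open>y'\<close> alternates in sign along the
  roots of \<open>y\<close>, so does \<open>y''\<close> along the negative ones, which places a root of \<open>y''\<close> between any
  two neighbours. By parity there are no other negative roots of \<open>y''\<close>.
\<close>

section \<open>Increasing enumerations and sign changes along them\<close>

lemma increasing_enumeration_exists:
  assumes "finite A"
  shows "\<exists>f. increasing_enumeration f (card A) A"
proof -
  define xs where "xs = sorted_list_of_set A"
  have xs: "length xs = card A" "set xs = A" "sorted_wrt (<) xs"
    using assms by (simp_all add: xs_def)
  have "strict_mono_on {1..card A} (\<lambda>i. xs ! (i - 1))"
    unfolding strict_mono_on_def using xs by (auto intro!: sorted_wrt_nth_less[of "(<)" xs])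
  moreover have "(\<lambda>i. xs ! (i - 1)) ` {1..card A} = A"
  proof -
    have "(\<lambda>i. i - 1) ` {1..card A} = {..<card A}"
      by (auto simp: image_iff intro!: bexI[of _ "Suc _"])
    then have "(\<lambda>i. xs ! (i - 1)) ` {1..card A} = (!) xs ` {..<card A}"
      by (metis image_image)
    also have "\<dots> = A"
      using xs by (metis atLeast0LessThan list.set_map map_nth set_upt)
    finally show ?thesis .
  qed
  ultimately show ?thesis
    unfolding increasing_enumeration_def by blast
qed

text \<open>The elements above \<open>f i\<close> are the images of the later indices. Since the
  count depends on \<open>A\<close> alone, it makes enumerations unique and turns steps of the index
  into changes of parity.\<close>

lemma increasing_enumeration_card_greater:
  assumes f: "increasing_enumeration f m A" and i: "i \<in> {1..m}"
  shows "card {x \<in> A. f i < x} = m - i"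
proof -
  have mono: "strict_mono_on {1..m} f" and A: "A = f ` {1..m}"
    using f by (auto simp: increasing_enumeration_def)
  have "{x \<in> A. f i < x} = f ` {i<..m}"
    using i strict_mono_on_less[OF mono] by (auto simp: A)
  moreover have "inj_on f {i<..m}"
    using strict_mono_on_imp_inj_on[OF mono] by (rule inj_on_subset) auto
  ultimately show ?thesis
    by (simp add: card_image)
qed

lemma increasing_enumeration_unique:
  assumes f: "increasing_enumeration f m A" and g: "increasing_enumeration g m A"
    and i: "i \<in> {1..m}"
  shows "f i = g i"
proof -
  have "f i \<in> A" using f i by (auto simp: increasing_enumeration_def)
  then obtain j where j: "j \<in> {1..m}" "f i = g j"
    using g by (auto simp: increasing_enumeration_def)
  have "m - i = m - j"
    using increasing_enumeration_card_greater[OF f i] increasing_enumeration_card_greater[OF g j(1)] j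
    by simp
  then have "i = j" using i j(1) by auto
  then show ?thesis using j(2) by simp
qed

text \<open>Passing to the next element of \<open>A\<close> lowers the count by one, so the sign
  flips and the intermediate value theorem gives a root in each gap. Monotonicity of
  \<open>g\<close> makes these roots distinct, so that they can be compared with a degree or a
  cardinality.\<close>

lemma alternating_signs_roots:
  fixes p :: "real poly"
  assumes f: "increasing_enumeration f m A" and c: "c \<noteq> 0"
    and sgn: "\<And>x. x \<in> A \<Longrightarrow> sgn (poly p x) = c * (-1) ^ card {y \<in> A. x < y}"
  obtains g where "strict_mono_on {1..m - 1} g"
    and "\<And>i. i \<in> {1..m - 1} \<Longrightarrow> g i \<in> {f i<..<f (i + 1)} \<and> poly p (g i) = 0"
proof -
  have mono: "strict_mono_on {1..m} f" and A: "A = f ` {1..m}"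
    using f by (auto simp: increasing_enumeration_def)
  have "\<exists>x. x \<in> {f i<..<f (i + 1)} \<and> poly p x = 0" if i: "i \<in> {1..m - 1}" for i
  proof -
    have i': "i \<in> {1..m}" "i + 1 \<in> {1..m}" using i by auto
    have lt: "f i < f (i + 1)"
      using i' strict_mono_on_less[OF mono] by simp
    have "m - i = Suc (m - (i + 1))" using i by auto
    then have "sgn (poly p (f i)) = - sgn (poly p (f (i + 1)))"
      using i' sgn[of "f i"] sgn[of "f (i + 1)"] increasing_enumeration_card_greater[OF f]
      by (simp add: A)
    moreover have "sgn (poly p (f i)) \<noteq> 0"
      using i' sgn[of "f i"] c by (simp add: A)
    ultimately have "poly p (f i) * poly p (f (i + 1)) < 0"
      by (auto simp: sgn_if mult_less_0_iff split: if_splits)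
    from poly_IVT[OF lt this] show ?thesis by auto
  qed
  then obtain g where g: "\<And>i. i \<in> {1..m - 1} \<Longrightarrow> g i \<in> {f i<..<f (i + 1)} \<and> poly p (g i) = 0"
    by metis
  have "g i < g j" if "i \<in> {1..m - 1}" "j \<in> {1..m - 1}" "i < j" for i j
  proof -
    have "f (i + 1) \<le> f j"
      using that by (intro strict_mono_on_leD[OF mono]) auto
    then show ?thesis using g[OF that(1)] g[OF that(2)] by auto
  qed
  then show thesis
    by (intro that[of g] g) (auto simp: strict_mono_on_def)
qed

section \<open>Signs and root counts of polynomials\<close>

lemma poly_eq_prod_roots:
  fixes q :: "'a::idom poly"
  assumes R: "finite R" "card R = degree q" and root: "\<And>x. x \<in> R \<Longrightarrow> poly q x = 0"
  shows "q = smult (lead_coeff q) (\<Prod>r\<in>R. [:- r, 1:])"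
proof (rule poly_eqI_degree_lead_coeff[where A = R and n = "degree q"])
  let ?P = "\<Prod>r\<in>R. [:- r, 1:]"
  have deg: "degree ?P = degree q"
    by (subst degree_prod_eq_sum_degree) (use R in auto)
  have "lead_coeff ?P = 1" by (simp add: lead_coeff_prod)
  then show "coeff q (degree q) = coeff (smult (lead_coeff q) ?P) (degree q)"
    by (simp add: deg)
  show "degree (smult (lead_coeff q) ?P) \<le> degree q"
    using deg by (metis degree_smult_le)
  show "poly q x = poly (smult (lead_coeff q) ?P) x" if "x \<in> R" for x
    using root[OF that] that R by (auto simp: poly_prod)
qed (use R in auto)

lemma sgn_prod_diff:
  fixes x :: "'a::linordered_idom"
  assumes "finite R" "x \<notin> R"
  shows "sgn (\<Prod>r\<in>R. x - r) = (-1) ^ card {r \<in> R. x < r}"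
  using assms
proof (induction R)
  case (insert a R)
  have "{r \<in> insert a R. x < r} = (if x < a then insert a {r \<in> R. x < r} else {r \<in> R. x < r})"
    by auto
  then show ?case
    using insert by (auto simp: sgn_mult)
qed simp

lemma sgn_poly_real_rooted:
  fixes q :: "real poly"
  assumes "finite R" "card R = degree q" "\<And>x. x \<in> R \<Longrightarrow> poly q x = 0" "x \<notin> R"
  shows "sgn (poly q x) = sgn (lead_coeff q) * (-1) ^ card {r \<in> R. x < r}"
proof -
  have "poly q x = lead_coeff q * (\<Prod>r\<in>R. x - r)"
    by (subst poly_eq_prod_roots[OF assms(1-3)]) (simp_all add: poly_prod)
  then show ?thesis using sgn_prod_diff[OF assms(1,4)] by (simp add: sgn_mult)
qed

text \<open>With the factor vanishing at \<open>x\<close> split off, only the term of the product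
  rule that differentiates this factor survives at \<open>x\<close>. Each other factor is negative
  exactly when its root lies above \<open>x\<close>.\<close>

lemma sgn_pderiv_real_rooted:
  fixes q :: "real poly"
  assumes "finite R" "card R = degree q" "\<And>x. x \<in> R \<Longrightarrow> poly q x = 0" "x \<in> R"
  shows "sgn (poly (pderiv q) x) = sgn (lead_coeff q) * (-1) ^ card {r \<in> R. x < r}"
proof -
  have "q = smult (lead_coeff q) ([:- x, 1:] * (\<Prod>r\<in>R - {x}. [:- r, 1:]))"
    using poly_eq_prod_roots[OF assms(1-3)] assms(1,4) by (metis prod.remove)
  then have "pderiv q = smult (lead_coeff q) (pderiv ([:- x, 1:] * (\<Prod>r\<in>R - {x}. [:- r, 1:])))"
    by (metis pderiv_smult)
  also have "poly \<dots> x = lead_coeff q * (\<Prod>r\<in>R - {x}. x - r)"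
    unfolding pderiv_mult by (simp add: pderiv_pCons poly_prod)
  finally have "poly (pderiv q) x = lead_coeff q * (\<Prod>r\<in>R - {x}. x - r)" .
  moreover have "{r \<in> R - {x}. x < r} = {r \<in> R. x < r}" by auto
  ultimately show ?thesis
    using sgn_prod_diff[of "R - {x}" x] assms(1) by (simp add: sgn_mult)
qed

text \<open>Negation pairs the negative roots with the positive ones; a possible root
  \<open>0\<close> is absorbed by the integer division.\<close>

lemma card_neg_roots:
  fixes p :: "real poly"
  assumes p: "p \<noteq> 0" and sym: "\<And>x. poly p x = 0 \<Longrightarrow> poly p (- x) = 0"
  shows "card (neg_roots p) = card {x. poly p x = 0} div 2"
proof -
  let ?R = "{x. poly p x = 0}"
  let ?N = "neg_roots p"
  have fin: "finite ?R" by (rule poly_roots_finite[OF p])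
  have R: "?R = (?N \<union> uminus ` ?N) \<union> (?R \<inter> {0})"
  proof (intro set_eqI iffI)
    fix x assume x: "x \<in> ?R"
    show "x \<in> (?N \<union> uminus ` ?N) \<union> (?R \<inter> {0})"
    proof (cases "x > 0")
      case True
      then have "- x \<in> ?N" using x sym by (simp add: neg_roots_def)
      then have "- (- x) \<in> uminus ` ?N" by (rule imageI)
      then show ?thesis by simp
    qed (use x in \<open>auto simp: neg_roots_def\<close>)
  qed (use sym in \<open>auto simp: neg_roots_def\<close>)
  have finN: "finite ?N" using fin by (rule finite_subset[rotated]) (auto simp: neg_roots_def)
  have "card ?R = card (?N \<union> uminus ` ?N) + card (?R \<inter> {0})"
    by (subst R, rule card_Un_disjoint) (use finN in \<open>auto simp: neg_roots_def\<close>)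
  also have "card (?N \<union> uminus ` ?N) = card ?N + card ?N"
    by (subst card_Un_disjoint) (use finN in \<open>auto simp: neg_roots_def card_image\<close>)
  finally have "card ?R = 2 * card ?N + card (?R \<inter> {0})" by simp
  moreover have "card (?R \<inter> {0}) \<le> 1"
    using card_mono[of "{0::real}" "?R \<inter> {0}"] by simp
  ultimately show ?thesis by simp
qed

section \<open>The equation for the derivatives, their parity and their roots\<close>

lemma gegenbauer_eigenvalue_pos:
  assumes "k < n" "n \<ge> 2"
  shows "real n * (real n - 1) - real k * (real k - 1) > 0"
  using gegenbauer_denominator_pos[OF assms(2,1)] assms by (simp add: field_simps)

context
  fixes p :: "real poly" and n :: nat and s :: real
  assumes degree_p: "degree p = n" and n_ge: "n \<ge> 2" and s_pos: "s > 0"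
    and ode: "smult (real n * (real n - 1)) p = [:- (s\<^sup>2), 0, 1:] * pderiv (pderiv p)"
begin

text \<open>Differentiating once, the derivative of \<open>x^2 - s^2\<close> raises
  \<open>2 * k * x\<close> to \<open>2 * (k + 1) * x\<close>, and the derivative of
  \<open>2 * k * x\<close> is absorbed on the left by
  \<open>k * (k - 1) + 2 * k = (k + 1) * k\<close>.\<close>

lemma higher_ode:
  "smult (real n * (real n - 1) - real k * (real k - 1)) ((pderiv ^^ k) p) =
     [:- (s\<^sup>2), 0, 1:] * (pderiv ^^ (k + 2)) p + [:0, 2 * real k:] * (pderiv ^^ (k + 1)) p"
proof (induction k)
  case 0
  then show ?case using ode by (simp add: numeral_2_eq_2)
next
  case (Suc k)
  show ?case
  proof (rule poly_ext)
    fix x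
    from arg_cong[OF Suc.IH, of "\<lambda>q. poly (pderiv q) x"]
    have "(real n * (real n - 1) - real k * (real k - 1)) * poly ((pderiv ^^ (k + 1)) p) x =
       (x\<^sup>2 - s\<^sup>2) * poly ((pderiv ^^ (k + 3)) p) x + 2 * x * poly ((pderiv ^^ (k + 2)) p) x
       + 2 * real k * x * poly ((pderiv ^^ (k + 2)) p) x + 2 * real k * poly ((pderiv ^^ (k + 1)) p) x"
      unfolding pderiv_mult pderiv_add pderiv_smult
      by (simp add: pderiv_pCons numeral_3_eq_3 algebra_simps power2_eq_square)
    then show "poly (smult (real n * (real n - 1) - real (Suc k) * (real (Suc k) - 1)) ((pderiv ^^ Suc k) p)) x =
       poly ([:- (s\<^sup>2), 0, 1:] * (pderiv ^^ (Suc k + 2)) p +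
         [:0, 2 * real (Suc k):] * (pderiv ^^ (Suc k + 1)) p) x"
      by (simp add: numeral_3_eq_3 algebra_simps power2_eq_square)
  qed
qed

lemma poly_higher_ode:
  "(real n * (real n - 1) - real k * (real k - 1)) * poly ((pderiv ^^ k) p) x =
     (x\<^sup>2 - s\<^sup>2) * poly (pderiv (pderiv ((pderiv ^^ k) p))) x
     + 2 * real k * x * poly (pderiv ((pderiv ^^ k) p)) x"
  using arg_cong[OF higher_ode[of k], of "\<lambda>q. poly q x"]
  by (simp add: algebra_simps power2_eq_square)

lemma higher_pderiv_nonzero: "k \<le> n \<Longrightarrow> (pderiv ^^ k) p \<noteq> 0"
proof (induction k)
  case 0
  then show ?case using degree_p n_ge by auto
next
  case (Suc k)
  then show ?case by (simp add: pderiv_eq_0_iff degree_higher_pderiv degree_p)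
qed

text \<open>The equation expresses the \<open>k\<close>-th derivative by the next two, so parity
  descends from the constant \<open>n\<close>-th derivative. The factor \<open>x\<close> in front of
  the next derivative makes up for its opposite parity.\<close>

lemma higher_pderiv_parity:
  "k \<le> n \<Longrightarrow> poly ((pderiv ^^ k) p) (- x) = (-1) ^ (n - k) * poly ((pderiv ^^ k) p) x"
proof (induction "n - k" arbitrary: k rule: less_induct)
  case less
  let ?y = "(pderiv ^^ k) p"
  show ?case
  proof (cases "k = n")
    case True
    then have "degree ?y = 0" by (simp add: degree_higher_pderiv degree_p)
    then show ?thesis using True by (auto elim!: degree_eq_zeroE)
  next
    case False
    with less.prems have k: "k < n" by simp
    have 1: "poly (pderiv ?y) (- x) = - ((-1) ^ (n - k)) * poly (pderiv ?y) x"
    proof -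
      have "n - k = Suc (n - Suc k)" using k by simp
      then show ?thesis using less.hyps[of "Suc k"] k by simp
    qed
    have 2: "poly (pderiv (pderiv ?y)) (- x) = (-1) ^ (n - k) * poly (pderiv (pderiv ?y)) x"
    \<comment> \<open>In this case \<open>k + 2\<close> exceeds \<open>n\<close> and is out of reach
      of the induction hypothesis; the second derivative is zero instead.\<close>
    proof (cases "Suc k = n")
      case True
      then have "degree (pderiv ?y) = 0" by (simp add: degree_pderiv degree_higher_pderiv degree_p)
      then have "pderiv (pderiv ?y) = 0" by (simp add: pderiv_eq_0_iff)
      then show ?thesis by simp
    next
      case False
      then have "n - k = Suc (Suc (n - Suc (Suc k)))" using k by simp
      then show ?thesis using less.hyps[of "Suc (Suc k)"] k False by simp
    qed
    let ?L = "real n * (real n - 1) - real k * (real k - 1)"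
    have "?L * poly ?y (- x) = (-1) ^ (n - k) * (?L * poly ?y x)"
      unfolding poly_higher_ode 1 2 by (simp add: algebra_simps)
    then have "?L * poly ?y (- x) = ?L * ((-1) ^ (n - k) * poly ?y x)"
      by (simp only: mult.left_commute)
    moreover have "?L \<noteq> 0" using gegenbauer_eigenvalue_pos[OF k n_ge] by simp
    ultimately show ?thesis by simp
  qed
qed

text \<open>Descending induction from the constant case \<open>k = n\<close>. The
  \<open>n - k - 1\<close> roots of the next derivative and the points \<plusminus>s bound
  \<open>n - k\<close> gaps with a root in each, which exhausts the degree. Simplicity of the roots
  is expressed by their number being the degree.\<close>

lemma roots_higher_pderiv:
  assumes "1 \<le> k" "k \<le> n"
  shows "card {x. poly ((pderiv ^^ k) p) x = 0} = n - k \<and>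
         {x. poly ((pderiv ^^ k) p) x = 0} \<subseteq> {-s<..<s}"
  using assms(2,1)
proof (induction k rule: inc_induct)
  case base
  have "degree ((pderiv ^^ n) p) = 0" by (simp add: degree_higher_pderiv degree_p)
  moreover have "(pderiv ^^ n) p \<noteq> 0" by (simp add: higher_pderiv_nonzero)
  ultimately have "{x. poly ((pderiv ^^ n) p) x = 0} = {}"
    by (auto elim!: degree_eq_zeroE)
  then show ?case by simp
next
  case (step k)
  let ?y = "(pderiv ^^ k) p"
  let ?q = "pderiv ?y"
  let ?L = "real n * (real n - 1) - real k * (real k - 1)"
  define R where "R = {x. poly ?q x = 0}"
  have q0: "?q \<noteq> 0" using higher_pderiv_nonzero[of "Suc k"] step.hyps by simp
  have finR: "finite R" unfolding R_def by (rule poly_roots_finite[OF q0])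
  have cardR: "card R = n - Suc k" and R: "R \<subseteq> {-s<..<s}"
    using step.IH by (simp_all add: R_def)
  have degq: "card R = degree ?q"
    by (simp add: cardR degree_pderiv degree_higher_pderiv degree_p)
  have rootR: "poly ?q x = 0" if "x \<in> R" for x using that by (simp add: R_def)
  have L: "?L > 0" using gegenbauer_eigenvalue_pos[of k n] step.hyps n_ge by simp
  define A where "A = insert (- s) (insert s R)"
  have finA: "finite A" using finR by (simp add: A_def)
  have sR: "s \<notin> R" "- s \<notin> R" using R by auto
  have cardA: "card A = n - k + 1"
    using finR sR s_pos step.hyps by (simp add: A_def cardR)
  \<comment> \<open>Multiplying by the positive eigenvalue allows the right-hand side of the
    equation to stand in for \<open>?y\<close>.\<close>
  have sgnL: "sgn (poly ?y x) = sgn (?L * poly ?y x)" for x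
    using L by (simp add: sgn_mult)
  have sgn: "sgn (poly ?y x) = sgn (lead_coeff ?q) * (-1) ^ card {y \<in> A. x < y}" if "x \<in> A" for x
  proof -
    consider "x = s" | "x = - s" | "x \<in> R" using \<open>x \<in> A\<close> by (auto simp: A_def)
    then show ?thesis
    proof cases
      case 1
      have "{y \<in> A. x < y} = {r \<in> R. x < r}"
        using 1 s_pos by (auto simp: A_def)
      \<comment> \<open>At \<plusminus>s the second-order term vanishes; the first-order term
        remains, with nonzero coefficient because \<open>k \<ge> 1\<close>.\<close>
      moreover have "sgn (poly ?y x) = sgn (poly ?q x)"
        unfolding sgnL poly_higher_ode using 1 s_pos step.prems by (simp add: sgn_mult)
      ultimately show ?thesis
        using sgn_poly_real_rooted[OF finR degq rootR, of x] sR 1 by simp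
    next
      case 2
      have "{y \<in> A. x < y} = insert s {r \<in> R. x < r}"
        using 2 s_pos by (auto simp: A_def)
      then have "card {y \<in> A. x < y} = Suc (card {r \<in> R. x < r})"
        using finR sR by simp
      \<comment> \<open>The sign change caused by \<open>x = - s\<close> matches the additional
        element \<open>s\<close> of \<open>A\<close> above it.\<close>
      moreover have "sgn (poly ?y x) = - sgn (poly ?q x)"
        unfolding sgnL poly_higher_ode using 2 s_pos step.prems by (simp add: sgn_mult)
      ultimately show ?thesis
        using sgn_poly_real_rooted[OF finR degq rootR, of x] sR 2 by simp
    next
      case 3
      have x: "- s < x" "x < s" using 3 R by auto
      then have "{y \<in> A. x < y} = insert s {r \<in> R. x < r}"
        by (auto simp: A_def)
      then have "card {y \<in> A. x < y} = Suc (card {r \<in> R. x < r})"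
        using finR sR by simp
      moreover have "x\<^sup>2 < s\<^sup>2" using x s_pos by (simp add: abs_less_iff power2_strict_mono)
      then have "sgn (poly ?y x) = - sgn (poly (pderiv ?q) x)"
        unfolding sgnL poly_higher_ode using rootR[OF 3] by (simp add: sgn_mult)
      ultimately show ?thesis
        using sgn_pderiv_real_rooted[OF finR degq rootR 3] by simp
    qed
  qed
  have "sgn (lead_coeff ?q) \<noteq> 0" using q0 by (simp add: sgn_eq_0_iff)
  obtain f where f: "increasing_enumeration f (card A) A"
    using increasing_enumeration_exists[OF finA] by blast
  obtain g where mono: "strict_mono_on {1..n - k} g"
    and g: "\<And>i. i \<in> {1..n - k} \<Longrightarrow> g i \<in> {f i<..<f (i + 1)} \<and> poly ?y (g i) = 0"
    using alternating_signs_roots[OF f \<open>sgn (lead_coeff ?q) \<noteq> 0\<close> sgn] by (auto simp: cardA)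
  have y0: "?y \<noteq> 0" using higher_pderiv_nonzero[of k] step.hyps by simp
  let ?Y = "{x. poly ?y x = 0}"
  have finY: "finite ?Y" by (rule poly_roots_finite[OF y0])
  have "card ?Y \<le> n - k"
    using card_poly_roots_bound[OF y0] by (simp add: degree_higher_pderiv degree_p)
  moreover have sub: "g ` {1..n - k} \<subseteq> ?Y" using g by auto
  moreover have "card (g ` {1..n - k}) = n - k"
    using strict_mono_on_imp_inj_on[OF mono] by (simp add: card_image)
  ultimately have Y: "g ` {1..n - k} = ?Y" "card ?Y = n - k"
    using card_seteq[OF finY sub] card_mono[OF finY sub] by auto
  have "g i \<in> {-s<..<s}" if "i \<in> {1..n - k}" for i
  proof -
    have "f i \<in> A" "f (i + 1) \<in> A"
      using f that by (auto simp: increasing_enumeration_def cardA)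
    then have "- s \<le> f i" "f (i + 1) \<le> s"
      using R s_pos by (auto simp: A_def)
    then show ?thesis using g[OF that] by auto
  qed
  then have "g ` {1..n - k} \<subseteq> {-s<..<s}" by blast
  then show ?case using Y by simp
qed

section \<open>Negative roots of a derivative\<close>

lemma card_neg_roots_higher_pderiv:
  assumes "1 \<le> k" "k \<le> n"
  shows "finite (neg_roots ((pderiv ^^ k) p))" "card (neg_roots ((pderiv ^^ k) p)) = (n - k) div 2"
proof -
  have y0: "(pderiv ^^ k) p \<noteq> 0" using higher_pderiv_nonzero assms by simp
  have "finite {x. poly ((pderiv ^^ k) p) x = 0}" by (rule poly_roots_finite[OF y0])
  then show "finite (neg_roots ((pderiv ^^ k) p))"
    by (rule finite_subset[rotated]) (auto simp: neg_roots_def)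
  show "card (neg_roots ((pderiv ^^ k) p)) = (n - k) div 2"
    using card_neg_roots[OF y0] higher_pderiv_parity[OF assms(2)] roots_higher_pderiv[OF assms] by simp
qed

text \<open>The nonnegative roots contribute the same factor at every negative root
  \<open>x\<close>. Splitting it off leaves a sign of the form required by
  \<open>alternating_signs_roots\<close>, with only the negative roots counted.\<close>

lemma sgn_second_pderiv_at_neg_root:
  assumes k: "1 \<le> k" "k \<le> n"
  defines "y \<equiv> (pderiv ^^ k) p"
  assumes x: "x \<in> neg_roots y"
  shows "sgn (poly (pderiv (pderiv y)) x) =
    - sgn (lead_coeff y) * (-1) ^ card {r. 0 \<le> r \<and> poly y r = 0} *
    (-1) ^ card {r \<in> neg_roots y. x < r}"
proof -
  let ?R = "{x. poly y x = 0}"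
  have y0: "y \<noteq> 0" unfolding y_def using higher_pderiv_nonzero k by simp
  have fin: "finite ?R" by (rule poly_roots_finite[OF y0])
  have deg: "card ?R = degree y" and R: "?R \<subseteq> {-s<..<s}"
    using roots_higher_pderiv[OF k] by (simp_all add: y_def degree_higher_pderiv degree_p)
  have x': "x < 0" "poly y x = 0" using x by (auto simp: neg_roots_def)
  have "{r \<in> ?R. x < r} = {r. 0 \<le> r \<and> poly y r = 0} \<union> {r \<in> neg_roots y. x < r}"
    using x' by (auto simp: neg_roots_def)
  moreover have "card \<dots> = card {r. 0 \<le> r \<and> poly y r = 0} + card {r \<in> neg_roots y. x < r}"
    by (rule card_Un_disjoint) (auto intro: finite_subset[OF _ fin] simp: neg_roots_def)
  ultimately have y1: "sgn (poly (pderiv y) x) =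
      sgn (lead_coeff y) * (-1) ^ (card {r. 0 \<le> r \<and> poly y r = 0} + card {r \<in> neg_roots y. x < r})"
    using sgn_pderiv_real_rooted[OF fin deg, of x] x' by simp
  have "- s < x" "x < s" using R x' by auto
  then have "s\<^sup>2 - x\<^sup>2 > 0" using s_pos by (simp add: abs_less_iff power2_strict_mono)
  then have "sgn (poly (pderiv (pderiv y)) x) = sgn ((s\<^sup>2 - x\<^sup>2) * poly (pderiv (pderiv y)) x)"
    by (simp add: sgn_mult)
  also have "(s\<^sup>2 - x\<^sup>2) * poly (pderiv (pderiv y)) x = 2 * real k * x * poly (pderiv y) x"
    using poly_higher_ode[of k x] x' by (simp add: y_def algebra_simps)
  also have "sgn \<dots> = - sgn (poly (pderiv y) x)"
    using k x' by (simp add: sgn_mult)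
  finally show ?thesis by (simp add: y1 power_add)
qed

end

section \<open>The Gegenbauer polynomial and the interlacing\<close>

lemma gegenbauer_ode:
  assumes n: "n \<ge> 3"
  obtains s where "s > 0"
    "smult (real n * (real n - 1)) (gegenbauer n) =
       [:- (s\<^sup>2), 0, 1:] * pderiv (pderiv (gegenbauer n))"
proof -
  let ?D = "real n * (real n - 1)"
  have D: "?D > 0" using n by simp
  \<comment> \<open>Chosen so that the cofactor of the second derivative becomes
    \<open>(x^2 - s^2) / ?D\<close>; \<open>gegenbauer_const n\<close> is negative, hence
    \<open>s\<close> is real and positive.\<close>
  define s where "s = sqrt (- gegenbauer_const n * ?D)"
  have "- gegenbauer_const n * ?D > 0"
    using gegenbauer_denominator_pos[of n "n - 2"] n D by (simp add: gegenbauer_const_def)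
  then have s: "s > 0" "s\<^sup>2 = - gegenbauer_const n * ?D" by (simp_all add: s_def)
  have "smult ?D (gegenbauer n) =
      smult ?D ([:gegenbauer_const n, 0, 1 / ?D:] * pderiv (pderiv (gegenbauer n)))"
    using is_gegenbauer_cofactor[OF n is_gegenbauer_gegenbauer[OF n]] by simp
  also have "\<dots> = smult ?D [:gegenbauer_const n, 0, 1 / ?D:] * pderiv (pderiv (gegenbauer n))"
    by (rule mult_smult_left[symmetric])
  also have "smult ?D [:gegenbauer_const n, 0, 1 / ?D:] = [:- (s\<^sup>2), 0, 1:]"
    using D s n by (simp add: mult.commute)
  finally show thesis using s that by blast
qed

theorem theorem20:
  fixes n k l :: nat
  assumes "n \<ge> 3" and "1 \<le> k" and "k + 2 \<le> n"
    and "l = (n - k) div 2"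
  defines "Z \<equiv> neg_roots ((pderiv ^^ k) (gegenbauer n))"
    and "M \<equiv> neg_roots ((pderiv ^^ (k + 2)) (gegenbauer n))"
  shows "(\<exists>\<zeta>. increasing_enumeration \<zeta> l Z) \<and>
         (\<exists>\<mu>. increasing_enumeration \<mu> (l - 1) M) \<and>
         (\<forall>\<zeta> \<mu>. increasing_enumeration \<zeta> l Z \<longrightarrow> increasing_enumeration \<mu> (l - 1) M \<longrightarrow>
            (\<forall>i\<in>{1..l - 1}. \<mu> i \<in> {\<zeta> i<..<\<zeta> (i + 1)}))"
proof (intro conjI allI impI ballI)
  let ?y = "(pderiv ^^ k) (gegenbauer n)"
  obtain s where s: "s > 0" and ode: "smult (real n * (real n - 1)) (gegenbauer n) =
       [:- (s\<^sup>2), 0, 1:] * pderiv (pderiv (gegenbauer n))"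
    using gegenbauer_ode[OF assms(1)] by blast
  have deg: "degree (gegenbauer n) = n"
    using is_gegenbauer_gegenbauer[OF assms(1)] by (simp add: is_gegenbauer_def)
  have n: "n \<ge> 2" using assms(1) by simp
  note facts = deg n s ode
  have Z: "finite Z" "card Z = l"
    using card_neg_roots_higher_pderiv[OF facts, of k] assms(2-4) by (simp_all add: Z_def)
  have M: "finite M" "card M = l - 1"
    using card_neg_roots_higher_pderiv[OF facts, of "k + 2"] assms(2-4) unfolding M_def by auto
  show "\<exists>\<zeta>. increasing_enumeration \<zeta> l Z"
    using increasing_enumeration_exists[OF Z(1)] Z(2) by simp
  show "\<exists>\<mu>. increasing_enumeration \<mu> (l - 1) M"
    using increasing_enumeration_exists[OF M(1)] M(2) by simp
  fix \<zeta> \<mu> i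
  assume \<zeta>: "increasing_enumeration \<zeta> l Z" and \<mu>: "increasing_enumeration \<mu> (l - 1) M"
    and i: "i \<in> {1..l - 1}"
  have k: "k \<le> n" using assms(3) by simp
  have "?y \<noteq> 0" by (rule higher_pderiv_nonzero[OF facts k])
  then have c: "- sgn (lead_coeff ?y) * (-1) ^ card {r. 0 \<le> r \<and> poly ?y r = 0} \<noteq> 0"
    by (simp add: sgn_eq_0_iff)
  obtain g where mono: "strict_mono_on {1..l - 1} g"
    and g: "\<And>i. i \<in> {1..l - 1} \<Longrightarrow>
      g i \<in> {\<zeta> i<..<\<zeta> (i + 1)} \<and> poly (pderiv (pderiv ?y)) (g i) = 0"
    using alternating_signs_roots[OF \<zeta> c
      sgn_second_pderiv_at_neg_root[OF facts assms(2) k, folded Z_def]] by blast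
  \<comment> \<open>Each constructed root lies to the left of a negative root
    \<open>\<zeta> (j + 1)\<close> and is therefore negative.\<close>
  have "g ` {1..l - 1} \<subseteq> M"
  proof
    fix x assume "x \<in> g ` {1..l - 1}"
    then obtain j where j: "j \<in> {1..l - 1}" "x = g j" by blast
    then have "\<zeta> (j + 1) \<in> Z" using \<zeta> by (auto simp: increasing_enumeration_def)
    then have "\<zeta> (j + 1) < 0" by (simp add: Z_def neg_roots_def)
    then show "x \<in> M" using g[OF j(1)] j(2) by (auto simp: M_def neg_roots_def)
  qed
  \<comment> \<open>Since \<open>M\<close> has exactly \<open>l - 1\<close> elements, the
    constructed roots are all of it; uniqueness of enumerations then carries their location over to
    the arbitrary \<open>\<mu>\<close>.\<close>
  moreover have "card (g ` {1..l - 1}) = card M"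
    using strict_mono_on_imp_inj_on[OF mono] M by (simp add: card_image)
  ultimately have "g ` {1..l - 1} = M" by (rule card_subset_eq[OF M(1)])
  with mono have "increasing_enumeration g (l - 1) M"
    by (simp add: increasing_enumeration_def)
  from increasing_enumeration_unique[OF \<mu> this i]
  show "\<mu> i \<in> {\<zeta> i<..<\<zeta> (i + 1)}" using g[OF i] by simp
qed

end
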